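(* Let $R$ be a commutative ring, $q: R^e \to R^d$ and $p: R^d \to R$ polynomials, $x \in R^e$, $v_1, \dots, v_k \in R^e$, and $y = q(x)$. Let $C_k = R[t][x_1,\dots,x_k]/(x_i^2 - t x_i : 1\le i\le k)$, and for $S\subseteq[k]$ write $c_S(t)\in R[t]$ for the $x^S$-coefficient of $(p \circ q)(x + \sum_i v_i x_i) \in C_k$. Then $$c_S(t) = \frac{1}{t^{|S|}} \sum_{\substack{H \subseteq \mathcal{P}_+(S) \\ \bigcup H = S}} \Delta\big(p;\, y;\, (\Delta(q;\, x;\, (tv_i)_{i \in T}))_{T \in H}\big), \qquad c_S(0) = \sum_{\pi \in \mathrm{Part}(S)} D\big(p;\, y;\, (D(q;\, x;\, v_B))_{B \in \pi}\big).$$ Each covering summand $\Delta(p;y;(\Delta(q;x;(tv_i)_{i\in T}))_{T\in H})$ is divisible by $t^{\mathrm{wt}(H)}$ in $R[t]$, where $\mathrm{wt}(H)=\sum_{T\in H}|T|$ (since $\Delta(q; x; (tv_i)_{i \in T})$ is divisible by $t^{|T|}$), so $c_S\in R[t]$. At $t = 0$, only the coverings with $\mathrm{wt}(H) = |S|$, namely the partitions of $S$, contribute.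
   Context: Polynomials $q:R^e\to R^d$, $p:R^d\to R$ are formal polynomials (resp. tuples thereof), which can be evaluated in any commutative $R$-algebra. $[k]=\{1,\dots,k\}$, $\mathcal{P}_+(S)$ is the set of nonempty subsets of $S$, and $\mathrm{Part}(S)$ is the set of partitions of $S$ into nonempty pairwise disjoint blocks (with $\mathrm{Part}(\emptyset)=\{\emptyset\}$). The algebra $C_k$ is a free $R[t]$-module with basis $x^S=\prod_{i\in S}x_i$, $S\subseteq[k]$. Forward difference: $\Delta(h;a;(w_i)_{i\in I})=\sum_{J\subseteq I}(-1)^{|I|-|J|}h(a+\sum_{i\in J}w_i)$, here evaluated over the ring $R[t]$ (the directions $tv_i$ lie in $R[t]^e$). Differential: $D(h;a;(w_i)_{i\in I})$ denotes the coefficient of $\varepsilon^I=\prod_{i\in I}\varepsilon_i$ in $h(a+\sum_{i\in I}\varepsilon_iw_i)$ computed in $R[\varepsilon_i:i\in I]/(\varepsilon_i^2)$ (componentwise for vector-valued $h$); $v_B=(v_i)_{i\in B}$. This is the iterated directional derivative when $\mathbb{Q}\subseteq R$. The phrase "only partitions contribute at $t=0$" means: for a covering $H$ of $S$ with $\mathrm{wt}(H)>|S|$, the polynomial $t^{-|S|}\Delta(p;y;(\Delta(q;x;(tv_i)_{i\in T}))_{T\in H})\in R[t]$ vanishes at $t=0$. *)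

theory Defs
  imports
    "HOL-Algebra.Algebraic_Closure_Type"
    "HOL-Library.Poly_Mapping"
    "HOL-Library.Disjoint_Sets"
begin

section \<open>Formal polynomials in several variables\<close>

text \<open>A polynomial is a finitely supported map from exponent vectors to coefficients; the
  multiplication of \<^type>\<open>poly_mapping\<close> is convolution. A vector in \<open>R^n\<close> is a function on
  \<^typ>\<open>nat\<close> of which only the components \<open>1, \<dots>, n\<close> matter.\<close>

type_synonym ('i, 'a) mpol = "('i \<Rightarrow>\<^sub>0 nat) \<Rightarrow>\<^sub>0 'a"

definition mconst :: "'a::comm_ring_1 \<Rightarrow> ('i, 'a) mpol"
  where "mconst c = Poly_Mapping.single 0 c"

definition mvar :: "'i \<Rightarrow> ('i, 'a::comm_ring_1) mpol"
  where "mvar i = Poly_Mapping.single (Poly_Mapping.single i 1) 1"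

definition mvars :: "('i, 'a::comm_ring_1) mpol \<Rightarrow> 'i set"
  where "mvars f = (\<Union>m \<in> Poly_Mapping.keys f. Poly_Mapping.keys m)"

definition mring :: "'i set \<Rightarrow> ('i, 'a::comm_ring_1) mpol ring"
  where "mring I = ring_of_type_algebra\<lparr>carrier := {f. mvars f \<subseteq> I}\<rparr>"

text \<open>Evaluation of a polynomial over \<open>'a\<close> at the point \<open>z\<close> of a commutative ring \<open>B\<close> that is
  an \<open>'a\<close>-algebra through \<open>\<phi>\<close>.\<close>

definition meval ::
    "('b, 'c) ring_scheme \<Rightarrow> ('a \<Rightarrow> 'b) \<Rightarrow> ('i \<Rightarrow> 'b) \<Rightarrow> ('i, 'a::comm_ring_1) mpol \<Rightarrow> 'b"
  where "meval B \<phi> z f =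
    (\<Oplus>\<^bsub>B\<^esub>m \<in> Poly_Mapping.keys f. \<phi> (Poly_Mapping.lookup f m) \<otimes>\<^bsub>B\<^esub>
      (\<Otimes>\<^bsub>B\<^esub>i \<in> Poly_Mapping.keys m. z i [^]\<^bsub>B\<^esub> Poly_Mapping.lookup m i))"

abbreviation meval_self :: "('i \<Rightarrow> 'a) \<Rightarrow> ('i, 'a::comm_ring_1) mpol \<Rightarrow> 'a"
  where "meval_self \<equiv> meval ring_of_type_algebra (\<lambda>r. r)"

abbreviation meval_poly :: "('i \<Rightarrow> 'a poly) \<Rightarrow> ('i, 'a::comm_ring_1) mpol \<Rightarrow> 'a poly"
  where "meval_poly \<equiv> meval ring_of_type_algebra (\<lambda>r. [:r:])"

text \<open>\<open>p \<circ> q\<close> as a formal polynomial in the variables \<open>1, \<dots>, e\<close>.\<close>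

definition mcomp ::
    "nat \<Rightarrow> (nat, 'a::comm_ring_1) mpol \<Rightarrow> (nat \<Rightarrow> (nat, 'a) mpol) \<Rightarrow> (nat, 'a) mpol"
  where "mcomp e p q = meval (mring {1..e}) mconst q p"


section \<open>The algebras \<open>A[x\<^sub>i : i \<in> I]/(x\<^sub>i\<^sup>2 - s x\<^sub>i)\<close>\<close>

text \<open>\<open>A = R[t]\<close> and \<open>s = t\<close> give \<open>C\<^sub>k\<close>; \<open>s = 0\<close> gives \<open>A[\<epsilon>\<^sub>i : i \<in> I]/(\<epsilon>\<^sub>i\<^sup>2)\<close>.\<close>

definition sq_ideal :: "'i set \<Rightarrow> 'a::comm_ring_1 \<Rightarrow> ('i, 'a) mpol set"
  where "sq_ideal I s = Idl\<^bsub>mring I\<^esub> ((\<lambda>i. mvar i ^ 2 - mconst s * mvar i) ` I)"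

definition sq_ring :: "'i set \<Rightarrow> 'a::comm_ring_1 \<Rightarrow> ('i, 'a) mpol set ring"
  where "sq_ring I s = mring I Quot sq_ideal I s"

definition sq_class :: "'i set \<Rightarrow> 'a::comm_ring_1 \<Rightarrow> ('i, 'a) mpol \<Rightarrow> ('i, 'a) mpol set"
  where "sq_class I s f = sq_ideal I s +>\<^bsub>mring I\<^esub> f"

definition sq_comb :: "'i set \<Rightarrow> 'a::comm_ring_1 \<Rightarrow> ('i set \<Rightarrow> 'a) \<Rightarrow> ('i, 'a) mpol set"
  where "sq_comb I s c = sq_class I s (\<Sum>T \<in> Pow I. mconst (c T) * (\<Prod>i\<in>T. mvar i))"

text \<open>The \<open>x\<^sup>S\<close>-coefficient of \<open>u\<close>. For finite \<open>I\<close> the coefficient family exists and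
  is unique, see \<open>sq_ring_free\<close> below.\<close>

definition sq_coeff :: "'i set \<Rightarrow> 'a::comm_ring_1 \<Rightarrow> ('i, 'a) mpol set \<Rightarrow> 'i set \<Rightarrow> 'a"
  where "sq_coeff I s u S = (THE c. (\<forall>T. \<not> T \<subseteq> I \<longrightarrow> c T = 0) \<and> u = sq_comb I s c) S"

text \<open>The point \<open>a + \<Sum>\<^sub>i x\<^sub>i w\<^sub>i\<close>, componentwise.\<close>

definition sq_point ::
    "'i set \<Rightarrow> 'a::comm_ring_1 \<Rightarrow> (nat \<Rightarrow> 'a) \<Rightarrow> ('i \<Rightarrow> nat \<Rightarrow> 'a) \<Rightarrow> nat \<Rightarrow> ('i, 'a) mpol set"
  where "sq_point I s a w j =
    sq_class I s (mconst (a j) + (\<Sum>i\<in>I. mvar i * mconst (w i j)))"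


section \<open>Forward difference and differential\<close>

definition fdiff ::
    "((nat \<Rightarrow> 'b) \<Rightarrow> 'b) \<Rightarrow> (nat \<Rightarrow> 'b) \<Rightarrow> 'i set \<Rightarrow> ('i \<Rightarrow> nat \<Rightarrow> 'b) \<Rightarrow> 'b::comm_ring_1"
  where "fdiff h a I w =
    (\<Sum>J \<in> Pow I. (-1) ^ (card I - card J) * h (\<lambda>j. a j + (\<Sum>i\<in>J. w i j)))"

definition pdiff ::
    "(nat, 'a) mpol \<Rightarrow> (nat \<Rightarrow> 'a) \<Rightarrow> 'i set \<Rightarrow> ('i \<Rightarrow> nat \<Rightarrow> 'a) \<Rightarrow> 'a::comm_ring_1"
  where "pdiff h a I w =
    sq_coeff I 0
      (meval (sq_ring I 0) (\<lambda>r. sq_class I 0 (mconst r)) (sq_point I 0 a w) h) I"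


section \<open>The two sides of the chain rule\<close>

abbreviation tvar :: "'a::comm_ring_1 poly"
  where "tvar \<equiv> [:0, 1:]"

definition comp_coeff ::
    "nat \<Rightarrow> nat \<Rightarrow> (nat, 'a) mpol \<Rightarrow> (nat \<Rightarrow> (nat, 'a) mpol) \<Rightarrow> (nat \<Rightarrow> 'a) \<Rightarrow> (nat \<Rightarrow> nat \<Rightarrow> 'a)
      \<Rightarrow> nat set \<Rightarrow> 'a::comm_ring_1 poly"
  where "comp_coeff e k p q x v S =
    sq_coeff {1..k} tvar
      (meval (sq_ring {1..k} tvar) (\<lambda>r. sq_class {1..k} tvar (mconst [:r:]))
        (sq_point {1..k} tvar (\<lambda>j. [:x j:]) (\<lambda>i j. [:v i j:]))
        (mcomp e p q)) S"

text \<open>\<open>\<Delta>(q; x; (t v\<^sub>i)\<^sub>i\<^sub>\<in>\<^sub>T)\<close> in \<open>R[t]^d\<close> and the summand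
  \<open>\<Delta>(p; q(x); (\<Delta>(q; x; (t v\<^sub>i)\<^sub>i\<^sub>\<in>\<^sub>T))\<^sub>T\<^sub>\<in>\<^sub>H)\<close> in \<open>R[t]\<close>.\<close>

definition inner_diff ::
    "(nat \<Rightarrow> (nat, 'a) mpol) \<Rightarrow> (nat \<Rightarrow> 'a) \<Rightarrow> (nat \<Rightarrow> nat \<Rightarrow> 'a) \<Rightarrow> nat set
      \<Rightarrow> nat \<Rightarrow> 'a::comm_ring_1 poly"
  where "inner_diff q x v T j =
    fdiff (\<lambda>z. meval_poly z (q j)) (\<lambda>l. [:x l:]) T (\<lambda>i l. tvar * [:v i l:])"

definition cover_diff ::
    "(nat, 'a) mpol \<Rightarrow> (nat \<Rightarrow> (nat, 'a) mpol) \<Rightarrow> (nat \<Rightarrow> 'a) \<Rightarrow> (nat \<Rightarrow> nat \<Rightarrow> 'a) \<Rightarrow> nat set set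
      \<Rightarrow> 'a::comm_ring_1 poly"
  where "cover_diff p q x v H =
    fdiff (\<lambda>z. meval_poly z p) (\<lambda>j. [:meval_self x (q j):]) H (inner_diff q x v)"

definition part_diff ::
    "(nat, 'a) mpol \<Rightarrow> (nat \<Rightarrow> (nat, 'a) mpol) \<Rightarrow> (nat \<Rightarrow> 'a) \<Rightarrow> (nat \<Rightarrow> nat \<Rightarrow> 'a) \<Rightarrow> nat set set
      \<Rightarrow> 'a::comm_ring_1"
  where "part_diff p q x v \<pi> =
    pdiff p (\<lambda>j. meval_self x (q j)) \<pi> (\<lambda>B j. pdiff (q j) x B v)"

definition coverings :: "'i set \<Rightarrow> 'i set set set"
  where "coverings S = {H. H \<subseteq> Pow S - {{}} \<and> \<Union>H = S}"

definition wt :: "'i set set \<Rightarrow> nat"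
  where "wt H = (\<Sum>T\<in>H. card T)"


section \<open>The algebras are free on the square-free monomials\<close>

lemma keys_add_nat:
  fixes m n :: "'i \<Rightarrow>\<^sub>0 nat"
  shows "Poly_Mapping.keys (m + n) = Poly_Mapping.keys m \<union> Poly_Mapping.keys n"
  by (auto simp: in_keys_iff lookup_add)

lemma mvars_add: "mvars (f + g) \<subseteq> mvars f \<union> mvars g"
  using Poly_Mapping.keys_add[of f g] unfolding mvars_def by fast

lemma mvars_uminus: "mvars (- f) = mvars f"
  by (simp add: mvars_def in_keys_iff set_eq_iff)

lemma mvars_mult: "mvars (f * g) \<subseteq> mvars f \<union> mvars g"
  using Poly_Mapping.keys_mult[of f g] unfolding mvars_def by (fastforce simp: keys_add_nat)

lemma mvars_single: "mvars (Poly_Mapping.single m c) \<subseteq> Poly_Mapping.keys m"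
  by (auto simp: mvars_def)

lemma mvars_0 [simp]: "mvars 0 = {}" and mvars_1 [simp]: "mvars 1 = {}"
  by (simp_all add: mvars_def)

lemma mring_simps [simp]:
  "carrier (mring I) = {f. mvars f \<subseteq> I}" "f \<otimes>\<^bsub>mring I\<^esub> g = f * g" "f \<oplus>\<^bsub>mring I\<^esub> g = f + g"
  "\<one>\<^bsub>mring I\<^esub> = 1" "\<zero>\<^bsub>mring I\<^esub> = 0"
  by (simp_all add: mring_def ring_of_type_algebra_def)

lemma mring_cring: "cring (mring I)"
proof (rule cringI)
  show "abelian_group (mring I)"
  proof (rule abelian_groupI)
    fix f assume "f \<in> carrier (mring I)"
    then show "\<exists>g\<in>carrier (mring I). g \<oplus>\<^bsub>mring I\<^esub> f = \<zero>\<^bsub>mring I\<^esub>"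
      by (intro bexI[of _ "- f"]) (auto simp: mvars_uminus)
  qed (auto simp: add_ac dest!: subsetD[OF mvars_add])
  show "comm_monoid (mring I)"
    by (rule comm_monoidI) (auto simp: mult_ac dest!: subsetD[OF mvars_mult])
qed (simp add: algebra_simps)

lemma mring_minus:
  assumes "f \<in> carrier (mring I)" "g \<in> carrier (mring I)"
  shows "f \<ominus>\<^bsub>mring I\<^esub> g = f - g"
proof -
  have "abelian_group (mring I)"
    using mring_cring by (rule cring.axioms(1)[THEN ring.is_abelian_group])
  then have "\<ominus>\<^bsub>mring I\<^esub> g = - g"
    by (rule abelian_group.minus_equality) (use assms in \<open>simp_all add: mvars_uminus\<close>)
  then show ?thesis unfolding a_minus_def by simp
qed

lemma mring_sum:
  assumes "\<And>a. a \<in> A \<Longrightarrow> mvars (f a) \<subseteq> I"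
  shows "mvars (sum f A) \<subseteq> I"
  using assms
proof (induction A rule: infinite_finite_induct)
  case (insert a A)
  then have "mvars (f a) \<union> mvars (sum f A) \<subseteq> I" by simp
  with mvars_add[of "f a" "sum f A"] have "mvars (f a + sum f A) \<subseteq> I" by (rule order.trans)
  with insert.hyps show ?case by simp
qed simp_all

lemma mring_monom: "mvars (mconst c * (\<Prod>i\<in>T. mvar i)) \<subseteq> T"
proof (cases "finite T")
  case True
  then have "mvars (\<Prod>i\<in>T. mvar i :: ('a, 'b) mpol) \<subseteq> T"
  proof (induction T)
    case empty
    then show ?case by (simp add: mvars_def)
  next
    case (insert i T)
    then show ?case
      using mvars_mult[of "mvar i" "\<Prod>i\<in>T. mvar i :: ('a, 'b) mpol"]
        mvars_single[of "Poly_Mapping.single i 1" "1::'b"]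
      by (auto simp: mvar_def)
  qed
  then show ?thesis
    using mvars_mult[of "mconst c" "\<Prod>i\<in>T. mvar i"] mvars_single[of "0 :: 'a \<Rightarrow>\<^sub>0 nat" c]
    by (auto simp: mconst_def)
qed (use mvars_single[of 0 c] in \<open>auto simp: mconst_def\<close>)

lemma mpol_expand:
  fixes f :: "('i, 'a::comm_ring_1) mpol"
  shows "f = (\<Sum>m \<in> Poly_Mapping.keys f. Poly_Mapping.single m (Poly_Mapping.lookup f m))"
  by (rule poly_mapping_eqI)
    (simp add: lookup_sum lookup_single when_def sum.delta in_keys_iff)

definition mdeg :: "('i \<Rightarrow>\<^sub>0 nat) \<Rightarrow> nat"
  where "mdeg m = (\<Sum>i \<in> Poly_Mapping.keys m. Poly_Mapping.lookup m i)"

lemma mdeg_add: "mdeg (m + n) = mdeg m + mdeg n"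
  unfolding mdeg_def by (rule setsum_keys_plus_distrib) auto

lemma card_keys_le: "card (Poly_Mapping.keys m) \<le> mdeg m"
  unfolding mdeg_def card_eq_sum by (rule sum_mono) (simp add: in_keys_iff Suc_le_eq)

definition sq_red :: "'a::comm_ring_1 \<Rightarrow> 'i set \<Rightarrow> ('i, 'a) mpol \<Rightarrow> 'a"
  where "sq_red s S f = (\<Sum>m \<in> Poly_Mapping.keys f.
    if Poly_Mapping.keys m = S then Poly_Mapping.lookup f m * s ^ (mdeg m - card S) else 0)"

lemma sq_red_add: "sq_red s S (f + g) = sq_red s S f + sq_red s S g"
  unfolding sq_red_def
  by (rule setsum_keys_plus_distrib[where f = "\<lambda>m c. if Poly_Mapping.keys m = S
        then c * s ^ (mdeg m - card S) else 0"]) (auto simp: algebra_simps)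

lemma sq_red_0 [simp]: "sq_red s S 0 = 0"
  by (simp add: sq_red_def)

lemma sq_red_diff: "sq_red s S (f - g) = sq_red s S f - sq_red s S g"
  using sq_red_add[of s S "f - g" g] by simp

lemma sq_red_sum: "sq_red s S (sum f A) = (\<Sum>a\<in>A. sq_red s S (f a))"
  by (induction A rule: infinite_finite_induct) (simp_all add: sq_red_add)

lemma sq_red_single:
  "sq_red s S (Poly_Mapping.single m c)
    = (if Poly_Mapping.keys m = S then c * s ^ (mdeg m - card S) else 0)"
  by (cases "c = 0") (simp_all add: sq_red_def)

lemma mvar_gen:
  "Poly_Mapping.single m c * (mvar i ^ 2 - mconst s * mvar i)
    = Poly_Mapping.single (m + Poly_Mapping.single i 2) c
      - Poly_Mapping.single (m + Poly_Mapping.single i 1) (c * s)"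
  unfolding power2_eq_square
  by (simp add: mvar_def mconst_def mult_single algebra_simps numeral_2_eq_2 flip: single_add)

lemma sq_red_gen: "sq_red s S (g * (mvar i ^ 2 - mconst s * mvar i)) = 0"
proof -
  have 1: "sq_red s S (Poly_Mapping.single m c * (mvar i ^ 2 - mconst s * mvar i)) = 0" for m c
  proof (cases "insert i (Poly_Mapping.keys m) = S")
    case True
    then have "card S \<le> mdeg m + 1"
      using card_keys_le[of m] by (auto simp: card_insert_if)
    then have "mdeg m + 2 - card S = Suc (mdeg m + 1 - card S)"
      by simp
    then have pow: "s ^ (mdeg m + 2 - card S) = s * s ^ (mdeg m + 1 - card S)"
      by (simp only: power_Suc)
    have "mdeg (Poly_Mapping.single i n) = n" for n
      by (simp add: mdeg_def)
    moreover have "Poly_Mapping.keys (m + Poly_Mapping.single i n) = S" if "n \<noteq> 0" for n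
      using that True by (auto simp: keys_add_nat)
    ultimately show ?thesis
      unfolding mvar_gen sq_red_diff sq_red_single mdeg_add by (simp add: pow mult.assoc del: add_2_eq_Suc')
  next
    case False
    then have "Poly_Mapping.keys (m + Poly_Mapping.single i n) \<noteq> S" if "n \<noteq> 0" for n
      using that by (auto simp: keys_add_nat)
    then show ?thesis
      unfolding mvar_gen sq_red_diff sq_red_single by simp
  qed
  have "sq_red s S ((\<Sum>m \<in> Poly_Mapping.keys g.
      Poly_Mapping.single m (Poly_Mapping.lookup g m)) * (mvar i ^ 2 - mconst s * mvar i)) = 0"
    unfolding sum_distrib_right sq_red_sum by (simp only: 1 sum.neutral_const)
  then show ?thesis
    by (simp only: mpol_expand[symmetric])
qed

lemma gen_carrier:
  assumes "i \<in> I"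
  shows "mvar i ^ 2 - mconst s * mvar i \<in> carrier (mring I)"
proof -
  let ?f = "Poly_Mapping.single (Poly_Mapping.single i 2) 1 :: ('a, 'b) mpol"
  let ?g = "Poly_Mapping.single (Poly_Mapping.single i 1) s"
  have "mvar i ^ 2 - mconst s * mvar i = ?f + - ?g"
    using mvar_gen[of 0 1 i s] by simp
  moreover have "mvars ?f \<subseteq> {i}" "mvars (- ?g) \<subseteq> {i}"
    unfolding mvars_uminus by (rule order.trans[OF mvars_single], simp)+
  then have "mvars (?f + - ?g) \<subseteq> I"
    using mvars_add[of ?f "- ?g"] assms by blast
  ultimately show ?thesis by (simp only: mring_simps mem_Collect_eq)
qed

lemma sq_ideal_ideal: "ideal (sq_ideal I s) (mring I)"
proof -
  have "ring (mring I)"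
    using mring_cring by (rule cring.axioms(1))
  then show ?thesis
    unfolding sq_ideal_def by (rule ring.genideal_ideal) (rule image_subsetI, rule gen_carrier)
qed

lemma sq_red_ideal:
  fixes f :: "('i, 'a::comm_ring_1) mpol"
  assumes "f \<in> sq_ideal I s"
  shows "sq_red s S f = 0"
proof -
  interpret cring "mring I :: ('i, 'a) mpol ring" by (rule mring_cring)
  define K :: "('i, 'a) mpol set" where "K = {f. mvars f \<subseteq> I \<and> (\<forall>g. sq_red s S (g * f) = 0)}"
  have inv: "inv\<^bsub>add_monoid (mring I)\<^esub> f = - f" if "f \<in> K" for f
    using mring_minus[of 0 I f] that by (simp add: a_minus_def a_inv_def K_def mvars_def)
  have sub: "subgroup K (add_monoid (mring I))"
  proof (rule subgroup.intro)
    fix f g assume fg: "f \<in> K" "g \<in> K"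
    then show "f \<otimes>\<^bsub>add_monoid (mring I)\<^esub> g \<in> K"
      using mvars_add[of f g] by (auto simp: K_def distrib_left sq_red_add)
    have "sq_red s S (h * - f) = 0" for h
      using fg(1) sq_red_diff[of s S 0 "h * f"] by (simp add: K_def)
    then show "inv\<^bsub>add_monoid (mring I)\<^esub> f \<in> K"
      unfolding inv[OF fg(1)] using fg(1) by (simp add: K_def mvars_uminus)
  qed (auto simp: K_def mvars_def)
  have "ideal K (mring I)"
  proof (rule idealI[OF ring_axioms sub])
    fix f g :: "('i, 'a) mpol" assume fg: "f \<in> K" "g \<in> carrier (mring I)"
    then have "mvars (g * f) \<subseteq> I"
      using mvars_mult[of g f] by (auto simp: K_def)
    moreover have "sq_red s S (h * (g * f)) = 0" for h
      using fg(1) unfolding K_def by (simp flip: mult.assoc)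
    ultimately show "g \<otimes>\<^bsub>mring I\<^esub> f \<in> K" "f \<otimes>\<^bsub>mring I\<^esub> g \<in> K"
      by (simp_all add: K_def mult.commute)
  qed
  moreover have "(\<lambda>i. mvar i ^ 2 - mconst s * mvar i) ` I \<subseteq> K"
    using gen_carrier[of _ I s] by (auto simp: K_def sq_red_gen)
  ultimately have "sq_ideal I s \<subseteq> K"
    unfolding sq_ideal_def by (rule genideal_minimal)
  with assms have "sq_red s S (1 * f) = 0"
    unfolding K_def by blast
  then show ?thesis by simp
qed

lemma sq_class_eq_iff:
  assumes "mvars f \<subseteq> I" "mvars g \<subseteq> I"
  shows "sq_class I s f = sq_class I s g \<longleftrightarrow> f - g \<in> sq_ideal I s"
proof -
  interpret cring "mring I" by (rule mring_cring)
  show ?thesis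
    using quotient_eq_iff_same_a_r_cos[OF sq_ideal_ideal[of I s], of f g] assms
    by (simp add: sq_class_def mring_minus)
qed

lemma prod_mvar:
  "finite T \<Longrightarrow> (\<Prod>i\<in>T. mvar i) = Poly_Mapping.single (\<Sum>i\<in>T. Poly_Mapping.single i 1) 1"
  by (induction T rule: finite_induct) (simp_all add: mvar_def mult_single)

lemma keys_sum_single:
  "finite T \<Longrightarrow> Poly_Mapping.keys (\<Sum>i\<in>T. Poly_Mapping.single i (1::nat)) = T"
  by (induction T rule: finite_induct) (simp_all add: keys_add_nat)

lemma mdeg_sum_single: "mdeg (\<Sum>i\<in>T. Poly_Mapping.single i 1) = card T"
proof (induction T rule: infinite_finite_induct)
  case (insert i T)
  then show ?case by (simp add: mdeg_add) (simp add: mdeg_def)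
qed (simp_all add: mdeg_def)

definition sq_sum :: "'i set \<Rightarrow> ('i set \<Rightarrow> 'a::comm_ring_1) \<Rightarrow> ('i, 'a) mpol"
  where "sq_sum I c = (\<Sum>T \<in> Pow I. mconst (c T) * (\<Prod>i\<in>T. mvar i))"

lemma mvars_sq_sum: "mvars (sq_sum I c) \<subseteq> I"
  unfolding sq_sum_def by (rule mring_sum) (use mring_monom in fast)

lemma sq_red_sq_sum:
  assumes "finite I" "S \<subseteq> I"
  shows "sq_red s S (sq_sum I c) = c S"
proof -
  have "sq_red s S (mconst (c T) * (\<Prod>i\<in>T. mvar i)) = (if T = S then c S else 0)" if "T \<in> Pow I" for T
  proof -
    have T: "finite T" using that assms(1) by (auto intro: finite_subset)
    have "mconst (c T) * (\<Prod>i\<in>T. mvar i)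
        = Poly_Mapping.single (\<Sum>i\<in>T. Poly_Mapping.single i 1) (c T)"
      by (simp add: prod_mvar[OF T] mconst_def mult_single)
    then show ?thesis
      by (simp only: sq_red_single keys_sum_single[OF T] mdeg_sum_single) simp
  qed
  then have "sq_red s S (sq_sum I c) = (\<Sum>T \<in> Pow I. if T = S then c S else 0)"
    unfolding sq_sum_def sq_red_sum by (rule sum.cong[OF refl])
  then show ?thesis
    using assms by (simp add: sum.delta)
qed

lemma sq_sum_add: "sq_sum I c + sq_sum I c' = sq_sum I (\<lambda>T. c T + c' T)"
  by (simp add: sq_sum_def mconst_def single_add distrib_right sum.distrib)

lemma sq_ideal_add: "f \<in> sq_ideal I s \<Longrightarrow> g \<in> sq_ideal I s \<Longrightarrow> f + g \<in> sq_ideal I s"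
  using additive_subgroup.a_closed[OF ideal.axioms(1)[OF sq_ideal_ideal]] by fastforce

lemma sq_ideal_0: "0 \<in> sq_ideal I s"
  using additive_subgroup.zero_closed[OF ideal.axioms(1)[OF sq_ideal_ideal]] by fastforce

lemma sq_ideal_gen:
  assumes "i \<in> I" "Poly_Mapping.keys m \<subseteq> I"
  shows "Poly_Mapping.single m c * (mvar i ^ 2 - mconst s * mvar i) \<in> sq_ideal I s"
proof -
  interpret cring "mring I" by (rule mring_cring)
  have "mvar i ^ 2 - mconst s * mvar i \<in> sq_ideal I s"
    using genideal_self[of "(\<lambda>i. mvar i ^ 2 - mconst s * mvar i) ` I"] gen_carrier[of _ I s] assms(1)
    unfolding sq_ideal_def by blast
  moreover have "Poly_Mapping.single m c \<in> carrier (mring I)"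
    using mvars_single[of m c] assms(2) by auto
  ultimately show ?thesis
    using ideal.I_l_closed[OF sq_ideal_ideal] by fastforce
qed

lemma sq_sum_single_exists:
  assumes "finite I" "Poly_Mapping.keys m \<subseteq> I"
  shows "\<exists>b. Poly_Mapping.single m c - sq_sum I b \<in> sq_ideal I s"
  using assms(2)
proof (induction "mdeg m" arbitrary: m c rule: less_induct)
  case less
  let ?M = "\<Sum>i\<in>Poly_Mapping.keys m. Poly_Mapping.single i (1::nat)"
  show ?case
  proof (cases "\<exists>i. Poly_Mapping.lookup m i \<ge> 2")
    case True
    then obtain i where i: "Poly_Mapping.lookup m i \<ge> 2" by blast
    define n where "n = m - Poly_Mapping.single i 2"
    have m: "m = n + Poly_Mapping.single i 2"
      by (rule poly_mapping_eqI)
        (use i in \<open>auto simp: n_def lookup_add lookup_minus lookup_single when_def\<close>)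
    have keys: "Poly_Mapping.keys n \<subseteq> I" "i \<in> I"
      using less.prems unfolding m by (auto simp: keys_add_nat)
    have "\<exists>b. Poly_Mapping.single (n + Poly_Mapping.single i 1) (c * s) - sq_sum I b
        \<in> sq_ideal I s"
      by (rule less.hyps) (use keys in \<open>auto simp: m mdeg_add keys_add_nat\<close>, simp add: mdeg_def)
    then obtain b where b: "Poly_Mapping.single (n + Poly_Mapping.single i 1) (c * s) - sq_sum I b
        \<in> sq_ideal I s" ..
    have "Poly_Mapping.single m c - sq_sum I b \<in> sq_ideal I s"
      using sq_ideal_add[OF sq_ideal_gen[OF keys(2,1), of c s] b]
      unfolding mvar_gen by (simp add: m algebra_simps)
    then show ?thesis by blast
  next
    case False
    let ?K = "Poly_Mapping.keys m"
    have "m = ?M"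
    proof (rule poly_mapping_eqI)
      fix j
      have "Poly_Mapping.lookup ?M j = (if j \<in> ?K then 1 else 0)"
        by (simp add: lookup_sum lookup_single when_def sum.delta)
      moreover have "Poly_Mapping.lookup m j < 2" using False by (meson not_le)
      moreover have "j \<in> ?K \<longleftrightarrow> Poly_Mapping.lookup m j \<noteq> 0" by (simp add: in_keys_iff)
      ultimately show "Poly_Mapping.lookup m j = Poly_Mapping.lookup ?M j"
        by (auto simp: less_2_cases_iff)
    qed
    have "sq_sum I (\<lambda>T. if T = ?K then c else 0)
        = (\<Sum>T\<in>Pow I. if T = ?K then mconst c * (\<Prod>i\<in>T. mvar i) else 0)"
      unfolding sq_sum_def by (rule sum.cong) (auto simp: mconst_def)
    also have "\<dots> = mconst c * (\<Prod>i\<in>?K. mvar i)"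
      using less.prems assms(1) by (simp add: sum.delta)
    also have "\<dots> = Poly_Mapping.single ?M c"
      by (simp add: prod_mvar mconst_def mult_single)
    finally have "Poly_Mapping.single m c - sq_sum I (\<lambda>T. if T = ?K then c else 0) = 0"
      using \<open>m = ?M\<close> by simp
    then show ?thesis using sq_ideal_0 by metis
  qed
qed

lemma sq_sum_exists:
  assumes "finite I" "mvars f \<subseteq> I"
  shows "\<exists>b. f - sq_sum I b \<in> sq_ideal I s"
proof -
  have "\<exists>b. (\<Sum>m\<in>M. Poly_Mapping.single m (Poly_Mapping.lookup f m)) - sq_sum I b
      \<in> sq_ideal I s" if "finite M" "M \<subseteq> Poly_Mapping.keys f" for M
    using that
  proof (induction M rule: finite_induct)
    case empty
    have "sq_sum I (\<lambda>_. 0) = 0" by (simp add: sq_sum_def mconst_def)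
    then show ?case using sq_ideal_0 by (metis diff_0_right sum.empty)
  next
    case (insert m M)
    then obtain b where b: "(\<Sum>m\<in>M. Poly_Mapping.single m (Poly_Mapping.lookup f m)) - sq_sum I b
      \<in> sq_ideal I s" by auto
    have "Poly_Mapping.keys m \<subseteq> I" using insert.prems assms(2) by (auto simp: mvars_def)
    then obtain b' where
      b': "Poly_Mapping.single m (Poly_Mapping.lookup f m) - sq_sum I b' \<in> sq_ideal I s"
      using sq_sum_single_exists[OF assms(1)] by blast
    show ?case
      using sq_ideal_add[OF b' b] insert.hyps
      by (intro exI[of _ "\<lambda>T. b' T + b T"]) (simp add: algebra_simps flip: sq_sum_add)
  qed
  from this[of "Poly_Mapping.keys f"] show ?thesis
    by (simp flip: mpol_expand)
qed

lemma sq_ring_free: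
  assumes "finite I" "u \<in> carrier (sq_ring I s)"
  shows "\<exists>!c. (\<forall>T. \<not> T \<subseteq> I \<longrightarrow> c T = 0) \<and> u = sq_comb I s c"
proof -
  have comb: "sq_comb I s c = sq_class I s (sq_sum I c)" for c
    by (simp add: sq_comb_def sq_sum_def)
  obtain f where f: "mvars f \<subseteq> I" "u = sq_class I s f"
    using assms(2) unfolding sq_ring_def sq_class_def FactRing_simps by fastforce
  obtain b where b: "f - sq_sum I b \<in> sq_ideal I s"
    using sq_sum_exists[OF assms(1) f(1)] by blast
  let ?b = "\<lambda>T. if T \<subseteq> I then b T else 0"
  have "sq_sum I ?b = sq_sum I b"
    unfolding sq_sum_def by (rule sum.cong) auto
  then have "u = sq_comb I s ?b"
    using b f by (simp add: comb sq_class_eq_iff mvars_sq_sum)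
  then show ?thesis
  proof (intro ex1I[of _ ?b] conjI allI impI; (elim conjE)?)
    fix c assume c: "\<forall>T. \<not> T \<subseteq> I \<longrightarrow> c T = 0" "u = sq_comb I s c"
    have diff: "sq_sum I c - sq_sum I ?b \<in> sq_ideal I s"
      using c(2) \<open>u = sq_comb I s ?b\<close>
        sq_class_eq_iff[OF mvars_sq_sum mvars_sq_sum, where s = s]
      unfolding comb by metis
    have "c T = ?b T" for T
    proof (cases "T \<subseteq> I")
      case True
      then show ?thesis
        using sq_red_ideal[OF diff, of T] assms(1) by (simp add: sq_red_diff sq_red_sq_sum)
    qed (use c(1) in simp)
    then show "c = ?b" ..
  qed auto
qed

end

theory Submission
  imports Defs
begin

text \<open>Everything rests on one polynomial, \<open>F = h(a + \<Sum>\<^sub>i X\<^sub>i w\<^sub>i)\<close>, expanded in free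
  variables \<open>X\<^sub>i\<close> (\<open>perturb\<close>). Collect its monomials by their support \<open>T\<close>, and in each take out one
  factor \<open>X\<^sub>i\<close> for every \<open>i \<in> T\<close>. Putting \<open>X\<^sub>i = s\<^sub>i\<close> in the rest gives a number
  \<open>c\<^sub>T\<close> (\<open>weighted_coeff\<close>). Three specialisations of \<open>F\<close> read off this number:

  \<^item> modulo the relations \<open>X\<^sub>i\<^sup>2 = s X\<^sub>i\<close> a power \<open>X\<^sub>i\<^sup>m\<close> becomes \<open>s\<^bsup>m-1\<^esup> X\<^sub>i\<close>, so for a
    constant weight \<open>s\<close> the number \<open>c\<^sub>T\<close> is the coefficient of the square-free monomial on
    \<open>T\<close> (\<open>sq_coeff_meval\<close>);
  \<^item> at the cube vertex \<open>X\<^sub>i = s\<^sub>i\<close> for \<open>i \<in> J\<close>, and \<open>X\<^sub>i = 0\<close> otherwise, \<open>F\<close> takes the value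
    \<open>\<Sum>\<^sub>T\<^sub>\<subseteq>\<^sub>J (\<Prod>\<^sub>i\<^sub>\<in>\<^sub>T s\<^sub>i) c\<^sub>T\<close>. Moebius inversion over the subsets of \<open>J\<close> shows that the
    forward difference in the directions \<open>s\<^sub>i w\<^sub>i\<close> equals \<open>(\<Prod>\<^sub>i\<^sub>\<in>\<^sub>J s\<^sub>i) c\<^sub>J\<close>
    (\<open>fdiff_weighted\<close>);
  \<^item> if all weights vanish at \<open>t = 0\<close>, the homomorphism \<open>t \<mapsto> 0\<close> turns \<open>c\<^sub>T\<close> into the
    coefficient for weight \<open>0\<close>, which is the differential (\<open>weighted_coeff_0_pdiff\<close>).

  With \<open>s\<^sub>i = t\<close> this yields both \<open>t\<^bsup>|S|\<^esup> c\<^sub>S = \<Delta>(p \<circ> q; x; (t v\<^sub>i)\<^sub>i\<^sub>\<in>\<^sub>S)\<close> and the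
  divisibility of the inner differences, \<open>\<Delta>(q; x; (t v\<^sub>i)\<^sub>i\<^sub>\<in>\<^sub>T) = t\<^bsup>|T|\<^esup> u\<^sub>T\<close> with
  \<open>u\<^sub>T(0) = D(q; x; v\<^sub>T)\<close>. Applied once more to \<open>p\<close>, with weight \<open>t\<^bsup>|T|\<^esup>\<close> for the direction
  \<open>u\<^sub>T\<close>, it gives that the summand of a covering \<open>H\<close> is \<open>t\<^bsup>wt H\<^esup>\<close> times a polynomial whose value at \<open>0\<close>
  is the differential of \<open>p\<close> along those of \<open>q\<close> (\<open>cover_diff_eq\<close>). It is this second use that needs weights which vary
  with \<open>i\<close>.

  The sum over coverings is a chain rule for forward differences of arbitrary functions
  (\<open>fdiff_compose\<close>): a value of a function at a vertex of a cube is the sum of its differences over the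
  faces below, so expanding \<open>q\<close> and then \<open>p\<close> writes \<open>p(q(x + \<Sum>\<^sub>i\<^sub>\<in>\<^sub>J t v\<^sub>i))\<close> as a sum over all families
  \<open>H\<close> of nonempty subsets of \<open>J\<close>, and Moebius inversion keeps those with union exactly \<open>S\<close>. Finally,
  \<open>wt H\<close> counts the points of \<open>S\<close> by the number of members of \<open>H\<close> containing them, hence
  \<open>wt H \<ge> |S|\<close> with equality precisely for partitions; after division by \<open>t\<^bsup>|S|\<^esup>\<close> the other
  coverings keep a factor \<open>t\<close>.\<close>

section \<open>Evaluation of polynomials as a ring homomorphism\<close>

abbreviation type_ring :: "'a::comm_ring_1 ring"
  where "type_ring \<equiv> ring_of_type_algebra"

lemma type_ring_simps [simp]:
  "carrier type_ring = UNIV" "f \<otimes>\<^bsub>type_ring\<^esub> g = f * g" "f \<oplus>\<^bsub>type_ring\<^esub> g = f + g"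
  "\<one>\<^bsub>type_ring\<^esub> = 1" "\<zero>\<^bsub>type_ring\<^esub> = 0"
  by (simp_all add: ring_of_type_algebra_def)

lemma type_ring_pow [simp]: "a [^]\<^bsub>type_ring\<^esub> (n::nat) = a ^ n"
  by (induction n) (simp_all add: nat_pow_def mult.commute)

lemma type_ring_finsum [simp]: "finsum type_ring f A = sum f A"
  for f :: "'i \<Rightarrow> 'a::comm_ring_1"
proof -
  interpret cring "type_ring :: 'a ring" by (rule cring_from_type_algebra)
  show ?thesis by (induction A rule: infinite_finite_induct) simp_all
qed

lemma type_ring_finprod [simp]: "finprod type_ring f A = prod f A"
  for f :: "'i \<Rightarrow> 'a::comm_ring_1"
proof -
  interpret cring "type_ring :: 'a ring" by (rule cring_from_type_algebra)
  show ?thesis by (induction A rule: infinite_finite_induct) simp_all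
qed

text \<open>Homomorphisms of type-class rings are expressed through the carrier-based locale so that one
  naturality statement, \<open>hom_meval\<close> below, covers evaluation in types, in \<open>mring I\<close> and in the
  quotient rings alike.\<close>

definition type_hom :: "('a::comm_ring_1 \<Rightarrow> 'b::comm_ring_1) \<Rightarrow> bool"
  where "type_hom \<psi> \<longleftrightarrow> ring_hom_cring type_ring type_ring \<psi>"

lemma type_homI:
  assumes "\<And>a b. \<psi> (a + b) = \<psi> a + \<psi> b" "\<And>a b. \<psi> (a * b) = \<psi> a * \<psi> b" "\<psi> 1 = 1"
  shows "type_hom \<psi>"
  unfolding type_hom_def
  by (rule ring_hom_cring.intro; (rule cring_from_type_algebra)?)
    (simp add: ring_hom_cring_axioms_def ring_hom_def assms)

lemma type_hom_simps:
  assumes "type_hom \<psi>"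
  shows "\<psi> (a + b) = \<psi> a + \<psi> b" "\<psi> (a * b) = \<psi> a * \<psi> b" "\<psi> 1 = 1" "\<psi> 0 = 0"
    "\<psi> (sum f A) = (\<Sum>i\<in>A. \<psi> (f i))" "\<psi> (prod f A) = (\<Prod>i\<in>A. \<psi> (f i))"
    "\<psi> (a ^ n) = \<psi> a ^ n"
proof -
  interpret ring_hom_cring type_ring type_ring \<psi> using assms by (simp add: type_hom_def)
  show "\<psi> (a + b) = \<psi> a + \<psi> b" "\<psi> (a * b) = \<psi> a * \<psi> b" "\<psi> 1 = 1" "\<psi> 0 = 0"
    using hom_add[of a b] hom_mult[of a b] hom_one hom_zero by simp_all
  show "\<psi> (sum f A) = (\<Sum>i\<in>A. \<psi> (f i))" "\<psi> (prod f A) = (\<Prod>i\<in>A. \<psi> (f i))"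
    using hom_finsum[of f A] hom_finprod[of f A] by simp_all
  then show "\<psi> (a ^ n) = \<psi> a ^ n"
    by (induction n) (use hom_mult hom_one in simp_all)
qed

text \<open>Evaluation uses only ring operations, so every homomorphism commutes with it. This is used for
  the quotient map onto \<open>sq_ring\<close>, for evaluations themselves and for \<open>t \<mapsto> 0\<close>.\<close>

lemma (in ring_hom_cring) hom_meval:
  assumes \<phi>: "\<And>r. \<phi> r \<in> carrier R" and z: "\<And>i. i \<in> mvars f \<Longrightarrow> z i \<in> carrier R"
  shows "h (meval R \<phi> z f) = meval S (\<lambda>r. h (\<phi> r)) (\<lambda>i. h (z i)) f"
proof -
  have pow: "h (a [^] n) = h a [^]\<^bsub>S\<^esub> n" if "a \<in> carrier R" for a and n :: nat
    using that by (induction n) simp_all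
  have z': "z i \<in> carrier R" if "m \<in> Poly_Mapping.keys f" "i \<in> Poly_Mapping.keys m" for m i
    using z that by (auto simp: mvars_def)
  have m: "(\<Otimes>i\<in>Poly_Mapping.keys m. z i [^] Poly_Mapping.lookup m i) \<in> carrier R"
    if "m \<in> Poly_Mapping.keys f" for m
    using z'[OF that] by (intro R.finprod_closed) auto
  have "h (\<Otimes>i\<in>Poly_Mapping.keys m. z i [^] Poly_Mapping.lookup m i)
      = (\<Otimes>\<^bsub>S\<^esub>i\<in>Poly_Mapping.keys m. h (z i) [^]\<^bsub>S\<^esub> Poly_Mapping.lookup m i)"
    if "m \<in> Poly_Mapping.keys f" for m
    using z'[OF that]
    by (subst hom_finprod) (auto intro!: S.finprod_cong' simp: pow)
  then show ?thesis
    unfolding meval_def using m \<phi> z'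
    by (subst hom_finsum)
      (auto intro!: S.finsum_cong' S.m_closed S.finprod_closed simp: hom_mult)
qed

definition meval_monom :: "('i \<Rightarrow> 'b) \<Rightarrow> ('i \<Rightarrow>\<^sub>0 nat) \<Rightarrow> 'b::comm_ring_1"
  where "meval_monom z m = (\<Prod>i\<in>Poly_Mapping.keys m. z i ^ Poly_Mapping.lookup m i)"

lemma meval_type:
  "meval type_ring \<phi> z f
    = (\<Sum>m\<in>Poly_Mapping.keys f. \<phi> (Poly_Mapping.lookup f m) * meval_monom z m)"
  by (simp add: meval_def meval_monom_def)

lemma meval_monom_superset:
  assumes "finite A" "Poly_Mapping.keys m \<subseteq> A"
  shows "meval_monom z m = (\<Prod>i\<in>A. z i ^ Poly_Mapping.lookup m i)"
  unfolding meval_monom_def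
  by (rule prod.mono_neutral_left[OF assms]) (simp add: in_keys_iff)

lemma meval_monom_add: "meval_monom z (m + n) = meval_monom z m * meval_monom z n"
proof -
  let ?A = "Poly_Mapping.keys m \<union> Poly_Mapping.keys n"
  show ?thesis
    using meval_monom_superset[of ?A m z] meval_monom_superset[of ?A n z]
      meval_monom_superset[of ?A "m + n" z]
    by (simp add: keys_add_nat lookup_add power_add prod.distrib)
qed

lemma meval_monom_0 [simp]: "meval_monom z 0 = 1"
  by (simp add: meval_monom_def)

lemma meval_monom_single [simp]: "meval_monom z (Poly_Mapping.single i n) = z i ^ n"
  by (simp add: meval_monom_def)

lemma meval_add:
  assumes "type_hom \<phi>"
  shows "meval type_ring \<phi> z (f + g) = meval type_ring \<phi> z f + meval type_ring \<phi> z g"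
  unfolding meval_type
  by (rule setsum_keys_plus_distrib[where f = "\<lambda>m c. \<phi> c * meval_monom z m"])
    (simp_all add: type_hom_simps[OF assms] distrib_right)

lemma meval_0 [simp]: "meval type_ring \<phi> z 0 = 0"
  by (simp add: meval_type)

lemma meval_sum:
  assumes "type_hom \<phi>"
  shows "meval type_ring \<phi> z (sum f A) = (\<Sum>a\<in>A. meval type_ring \<phi> z (f a))"
  by (induction A rule: infinite_finite_induct) (simp_all add: meval_add[OF assms])

lemma meval_single:
  assumes "type_hom \<phi>"
  shows "meval type_ring \<phi> z (Poly_Mapping.single m c) = \<phi> c * meval_monom z m"
  by (cases "c = 0") (simp_all add: meval_type type_hom_simps[OF assms])

lemma meval_hom:
  assumes "type_hom \<phi>"
  shows "type_hom (meval type_ring \<phi> z)"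
proof (rule type_homI)
  fix f g
  let ?t = "\<lambda>f m. Poly_Mapping.single m (Poly_Mapping.lookup f m)"
  have single: "meval type_ring \<phi> z (Poly_Mapping.single m a * Poly_Mapping.single n b)
      = meval type_ring \<phi> z (Poly_Mapping.single m a) * meval type_ring \<phi> z (Poly_Mapping.single n b)" for m n a b
    by (simp add: mult_single meval_single[OF assms] meval_monom_add type_hom_simps[OF assms] mult_ac)
  \<comment> \<open>arbitrary index sets, as the instance \<open>A = keys f\<close> would be folded back to \<open>f\<close> too early\<close>
  have "meval type_ring \<phi> z (sum (?t f) A * sum (?t g) B)
      = meval type_ring \<phi> z (sum (?t f) A) * meval type_ring \<phi> z (sum (?t g) B)" for A B
    unfolding sum_product meval_sum[OF assms] single ..
  from this[of "Poly_Mapping.keys f" "Poly_Mapping.keys g"]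
  show "meval type_ring \<phi> z (f * g) = meval type_ring \<phi> z f * meval type_ring \<phi> z g"
    by (simp flip: mpol_expand)
next
  show "meval type_ring \<phi> z 1 = 1"
    using meval_single[OF assms, of z 0 1] by (simp add: type_hom_simps[OF assms])
qed (rule meval_add[OF assms])

lemma meval_mconst:
  assumes "type_hom \<phi>"
  shows "meval type_ring \<phi> z (mconst c) = \<phi> c"
  by (simp add: mconst_def meval_single[OF assms])

lemma meval_mvar:
  assumes "type_hom \<phi>"
  shows "meval type_ring \<phi> z (mvar i) = z i"
  by (simp add: mvar_def meval_single[OF assms] type_hom_simps[OF assms])

lemma type_hom_id: "type_hom (\<lambda>r. r)"
  by (rule type_homI) auto

lemma type_hom_const_poly: "type_hom (\<lambda>r. [:r:])"
  by (rule type_homI) auto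

lemma type_hom_poly: "type_hom (\<lambda>f. poly f c)"
  by (rule type_homI) auto

lemma type_hom_mconst: "type_hom mconst"
  by (rule type_homI) (auto simp: mconst_def single_add mult_single)

lemma type_hom_comp:
  assumes "type_hom \<psi>" "type_hom \<phi>"
  shows "type_hom (\<lambda>r. \<psi> (\<phi> r))"
  by (rule type_homI) (simp_all add: type_hom_simps[OF assms(1)] type_hom_simps[OF assms(2)])

lemma type_hom_meval:
  assumes "type_hom \<psi>"
  shows "\<psi> (meval type_ring \<phi> z f) = meval type_ring (\<lambda>r. \<psi> (\<phi> r)) (\<lambda>i. \<psi> (z i)) f"
  using ring_hom_cring.hom_meval[OF assms[unfolded type_hom_def], of \<phi> f z] by simp

text \<open>The inclusion of \<open>mring I\<close> into the type of all polynomials is a homomorphism, so evaluation may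
  be computed without the carrier.\<close>

lemma meval_mring:
  assumes "\<And>r. mvars (\<phi> r) \<subseteq> I" "\<And>i. i \<in> mvars f \<Longrightarrow> mvars (z i) \<subseteq> I"
  shows "meval (mring I) \<phi> z f = meval type_ring \<phi> z f"
proof -
  have "ring_hom_cring (mring I) type_ring (\<lambda>f. f)"
    by (rule ring_hom_cring.intro; (rule cring_from_type_algebra mring_cring)?)
      (simp add: ring_hom_cring_axioms_def ring_hom_def)
  from ring_hom_cring.hom_meval[OF this, of \<phi> f z] assms show ?thesis by simp
qed

section \<open>Coefficients of square-free monomials with weights\<close>

text \<open>Reducing \<open>F\<close> by the relations \<open>X\<^sub>i\<^sup>2 = s\<^sub>i X\<^sub>i\<close>, with a separate weight for each variable,
  leaves this coefficient at the square-free monomial on \<open>S\<close>.\<close>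

definition weighted_coeff :: "('i \<Rightarrow> 'a) \<Rightarrow> 'i set \<Rightarrow> ('i, 'a::comm_ring_1) mpol \<Rightarrow> 'a"
  where "weighted_coeff s S F = (\<Sum>m \<in> Poly_Mapping.keys F. if Poly_Mapping.keys m = S
    then Poly_Mapping.lookup F m * (\<Prod>i\<in>S. s i ^ (Poly_Mapping.lookup m i - 1)) else 0)"

lemma weighted_coeff_add:
  "weighted_coeff s S (f + g) = weighted_coeff s S f + weighted_coeff s S g"
  unfolding weighted_coeff_def
  by (rule setsum_keys_plus_distrib[where f = "\<lambda>m c. if Poly_Mapping.keys m = S
        then c * (\<Prod>i\<in>S. s i ^ (Poly_Mapping.lookup m i - 1)) else 0"])
    (auto simp: algebra_simps)

lemma weighted_coeff_sum:
  "weighted_coeff s S (sum f A) = (\<Sum>a\<in>A. weighted_coeff s S (f a))"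
  by (induction A rule: infinite_finite_induct)
    (simp_all add: weighted_coeff_add, simp_all add: weighted_coeff_def)

lemma weighted_coeff_single:
  "weighted_coeff s S (Poly_Mapping.single m c) = (if Poly_Mapping.keys m = S
    then c * (\<Prod>i\<in>S. s i ^ (Poly_Mapping.lookup m i - 1)) else 0)"
  by (cases "c = 0") (simp_all add: weighted_coeff_def)

lemma sq_red_weighted: "sq_red s S F = weighted_coeff (\<lambda>_. s) S F"
proof -
  have "s ^ (mdeg m - card (Poly_Mapping.keys m))
      = (\<Prod>i\<in>Poly_Mapping.keys m. s ^ (Poly_Mapping.lookup m i - 1))" for m :: "'b \<Rightarrow>\<^sub>0 nat"
  proof -
    have "mdeg m - card (Poly_Mapping.keys m)
        = (\<Sum>i\<in>Poly_Mapping.keys m. Poly_Mapping.lookup m i - 1)"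
      unfolding mdeg_def card_eq_sum
      by (rule sum_subtractf_nat[symmetric]) (simp add: in_keys_iff Suc_le_eq)
    then show ?thesis by (simp add: power_sum)
  qed
  then show ?thesis
    unfolding sq_red_def weighted_coeff_def by (intro sum.cong) auto
qed

text \<open>Change of base ring: \<open>meval type_ring (\<lambda>c. mconst (\<psi> c)) mvar\<close> applies \<open>\<psi>\<close> to every coefficient
  of a polynomial.\<close>

lemma weighted_coeff_map:
  fixes \<psi> :: "'a::comm_ring_1 \<Rightarrow> 'b::comm_ring_1" and F :: "('i, 'a) mpol"
  assumes "type_hom \<psi>"
  shows "\<psi> (weighted_coeff s S F)
    = weighted_coeff (\<lambda>i. \<psi> (s i)) S (meval type_ring (\<lambda>c. mconst (\<psi> c)) mvar F)"
proof -
  have hom: "type_hom (\<lambda>c. mconst (\<psi> c) :: ('i, 'b) mpol)"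
    by (rule type_hom_comp[OF type_hom_mconst assms])
  have "meval_monom mvar m = (Poly_Mapping.single m 1 :: ('i, 'b) mpol)" for m
  proof -
    have pow: "mvar i ^ n = (Poly_Mapping.single (Poly_Mapping.single i n) 1 :: ('i, 'b) mpol)" for i n
      by (induction n) (simp_all add: mvar_def mult_single flip: single_add)
    have "(\<Prod>i\<in>A. Poly_Mapping.single (g i) 1) = (Poly_Mapping.single (sum g A) 1 :: ('i, 'b) mpol)"
      for A and g :: "'i \<Rightarrow> 'i \<Rightarrow>\<^sub>0 nat"
      by (induction A rule: infinite_finite_induct) (simp_all add: mult_single)
    moreover have "(\<Sum>i\<in>Poly_Mapping.keys m. Poly_Mapping.single i (Poly_Mapping.lookup m i)) = m"
      by (rule poly_mapping_eqI)
        (simp add: lookup_sum lookup_single when_def sum.delta in_keys_iff)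
    ultimately show ?thesis
      unfolding meval_monom_def pow by simp
  qed
  then have "meval type_ring (\<lambda>c. mconst (\<psi> c)) mvar (Poly_Mapping.single m c)
      = (Poly_Mapping.single m (\<psi> c) :: ('i, 'b) mpol)" for m c
    by (simp add: meval_single[OF hom]) (simp add: mult_single mconst_def)
  then have "\<psi> (weighted_coeff s S (\<Sum>m\<in>A. Poly_Mapping.single m (Poly_Mapping.lookup F m)))
    = weighted_coeff (\<lambda>i. \<psi> (s i)) S (meval type_ring (\<lambda>c. mconst (\<psi> c)) mvar
        (\<Sum>m\<in>A. Poly_Mapping.single m (Poly_Mapping.lookup F m)))" for A
    by (simp add: meval_sum[OF hom] weighted_coeff_sum weighted_coeff_single
        type_hom_simps[OF assms] if_distrib[of \<psi>] cong: if_cong)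
  from this[of "Poly_Mapping.keys F"] show ?thesis by (simp flip: mpol_expand)
qed

text \<open>At a vertex of the cube only the monomials supported in \<open>J\<close> survive, and since
  \<open>s\<^sub>i\<^sup>m = s\<^sub>i \<cdot> s\<^sub>i\<^bsup>m-1\<^esup>\<close> for \<open>m \<ge> 1\<close>, those of support \<open>T\<close> share the factor
  \<open>\<Prod>\<^sub>i\<^sub>\<in>\<^sub>T s\<^sub>i\<close>.\<close>

lemma meval_cube_vertex:
  assumes "finite J"
  shows "meval type_ring (\<lambda>r. r) (\<lambda>i. if i \<in> J then s i else 0) F
    = (\<Sum>T\<in>Pow J. (\<Prod>i\<in>T. s i) * weighted_coeff s T F)"
proof -
  let ?z = "\<lambda>i. if i \<in> J then s i else 0"
  have monom: "c * meval_monom ?z m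
      = (\<Sum>T\<in>Pow J. (\<Prod>i\<in>T. s i) * weighted_coeff s T (Poly_Mapping.single m c))" for m c
  proof (cases "Poly_Mapping.keys m \<subseteq> J")
    case True
    let ?K = "Poly_Mapping.keys m"
    have "meval_monom ?z m = (\<Prod>i\<in>?K. s i * s i ^ (Poly_Mapping.lookup m i - 1))"
      unfolding meval_monom_def
    proof (rule prod.cong[OF refl])
      fix i assume i: "i \<in> ?K"
      then have "Poly_Mapping.lookup m i = Suc (Poly_Mapping.lookup m i - 1)"
        by (simp add: in_keys_iff)
      then have "?z i ^ Poly_Mapping.lookup m i = s i ^ Suc (Poly_Mapping.lookup m i - 1)"
        using True i by (simp add: subset_iff)
      then show "?z i ^ Poly_Mapping.lookup m i = s i * s i ^ (Poly_Mapping.lookup m i - 1)"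
        by (simp only: power_Suc)
    qed
    moreover have "(\<Sum>T\<in>Pow J. (\<Prod>i\<in>T. s i) * weighted_coeff s T (Poly_Mapping.single m c))
        = (\<Sum>T\<in>{?K}. (\<Prod>i\<in>T. s i) * weighted_coeff s T (Poly_Mapping.single m c))"
      by (rule sum.mono_neutral_right) (use True assms in \<open>auto simp: weighted_coeff_single\<close>)
    ultimately show ?thesis
      by (simp add: weighted_coeff_single prod.distrib mult_ac)
  next
    case False
    then obtain i where "i \<in> Poly_Mapping.keys m" "i \<notin> J" by blast
    then have "meval_monom ?z m = 0"
      unfolding meval_monom_def by (intro prod_zero bexI[of _ i]) (auto simp: in_keys_iff zero_power)
    moreover have "weighted_coeff s T (Poly_Mapping.single m c) = 0" if "T \<in> Pow J" for T
      using that False by (auto simp: weighted_coeff_single)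
    ultimately show ?thesis by simp
  qed
  have "weighted_coeff s T F = (\<Sum>m\<in>Poly_Mapping.keys F.
      weighted_coeff s T (Poly_Mapping.single m (Poly_Mapping.lookup F m)))" for T
    by (simp add: weighted_coeff_single) (simp add: weighted_coeff_def)
  then show ?thesis
    unfolding meval_type monom by (simp add: sum_distrib_left) (rule sum.swap)
qed

section \<open>One polynomial behind differences, differentials and coefficients\<close>

text \<open>The polynomial \<open>h(a + \<Sum>\<^sub>i X\<^sub>i w\<^sub>i)\<close> in the free variables \<open>X\<^sub>i\<close>. The base change \<open>\<phi>\<close> allows
  \<open>h\<close> over \<open>R\<close> to be evaluated at a point over \<open>R[t]\<close>.\<close>

definition perturb :: "('a::comm_ring_1 \<Rightarrow> 'b) \<Rightarrow> (nat \<Rightarrow> 'b) \<Rightarrow> 'i set \<Rightarrow> ('i \<Rightarrow> nat \<Rightarrow> 'b)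
    \<Rightarrow> (nat, 'a) mpol \<Rightarrow> ('i, 'b::comm_ring_1) mpol"
  where "perturb \<phi> a I w h = meval type_ring (\<lambda>r. mconst (\<phi> r))
    (\<lambda>j. mconst (a j) + (\<Sum>i\<in>I. mvar i * mconst (w i j))) h"

lemma mvars_mconst [simp]: "mvars (mconst c) = {}"
  using mvars_single[of 0 c] by (auto simp: mconst_def)

lemma mvars_perturb_point: "mvars (mconst c + (\<Sum>i\<in>I. mvar i * mconst (w i))) \<subseteq> I"
proof -
  have "mvars (mvar i * mconst (w i)) \<subseteq> I" if "i \<in> I" for i
    using mring_monom[of "w i" "{i}"] that by (auto simp: mult.commute)
  then show ?thesis
    using mvars_add[of "mconst c"] mring_sum[of I "\<lambda>i. mvar i * mconst (w i)" I] by fastforce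
qed

lemma mvars_meval:
  assumes "\<And>r. mvars (\<phi> r) \<subseteq> I" "\<And>i. i \<in> mvars f \<Longrightarrow> mvars (z i) \<subseteq> I"
  shows "mvars (meval type_ring \<phi> z f) \<subseteq> I"
proof -
  interpret cring "mring I" by (rule mring_cring)
  have "meval (mring I) \<phi> z f \<in> carrier (mring I)"
    unfolding meval_def
  proof (intro finsum_closed Pi_I m_closed finprod_closed nat_pow_closed)
    fix m i assume "m \<in> Poly_Mapping.keys f" "i \<in> Poly_Mapping.keys m"
    then have "i \<in> mvars f" by (auto simp: mvars_def)
    then show "z i \<in> carrier (mring I)" using assms(2) by simp
  qed (use assms(1) in simp)
  then show ?thesis by (simp add: meval_mring[where I = I] assms)
qed

text \<open>The reduction \<open>sq_red\<close> vanishes on the ideal and returns the coefficients of square-free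
  combinations, so it computes the coefficients of any class.\<close>

lemma sq_coeff_class:
  assumes "finite I" "mvars F \<subseteq> I" "S \<subseteq> I"
  shows "sq_coeff I s (sq_class I s F) S = weighted_coeff (\<lambda>_. s) S F"
proof -
  have "sq_class I s F \<in> carrier (sq_ring I s)"
    using assms(2) unfolding sq_ring_def sq_class_def FactRing_simps by fastforce
  from theI'[OF sq_ring_free[OF assms(1) this]]
  have "sq_class I s F = sq_comb I s (sq_coeff I s (sq_class I s F))"
    unfolding sq_coeff_def by blast
  then have "sq_class I s F = sq_class I s (sq_sum I (sq_coeff I s (sq_class I s F)))"
    by (simp add: sq_comb_def sq_sum_def)
  then have "F - sq_sum I (sq_coeff I s (sq_class I s F)) \<in> sq_ideal I s"
    using sq_class_eq_iff[OF assms(2) mvars_sq_sum] by blast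
  from sq_red_ideal[OF this, of S] show ?thesis
    by (simp add: sq_red_diff sq_red_sq_sum[OF assms(1,3)] flip: sq_red_weighted)
qed

lemma sq_coeff_meval:
  assumes "finite I" "S \<subseteq> I"
  shows "sq_coeff I s (meval (sq_ring I s) (\<lambda>r. sq_class I s (mconst (\<phi> r))) (sq_point I s a w) h) S
    = weighted_coeff (\<lambda>_. s) S (perturb \<phi> a I w h)"
proof -
  let ?z = "\<lambda>j. mconst (a j) + (\<Sum>i\<in>I. mvar i * mconst (w i j))"
  have hom: "ring_hom_cring (mring I) (sq_ring I s) (sq_class I s)"
    unfolding sq_ring_def sq_class_def
    by (rule ideal.rcos_ring_hom_cring[OF sq_ideal_ideal mring_cring])
  have z: "mvars (?z j) \<subseteq> I" for j
    by (rule mvars_perturb_point)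
  have "meval (sq_ring I s) (\<lambda>r. sq_class I s (mconst (\<phi> r))) (sq_point I s a w) h
      = sq_class I s (meval (mring I) (\<lambda>r. mconst (\<phi> r)) ?z h)"
    using ring_hom_cring.hom_meval[OF hom, of "\<lambda>r. mconst (\<phi> r)" h ?z] z
    by (simp add: sq_point_def[abs_def])
  also have "meval (mring I) (\<lambda>r. mconst (\<phi> r)) ?z h = perturb \<phi> a I w h"
    unfolding perturb_def by (rule meval_mring) (use z in auto)
  finally show ?thesis
    using sq_coeff_class[OF assms(1) _ assms(2)] mvars_meval[of "\<lambda>r. mconst (\<phi> r)" I h ?z] z
    by (simp add: perturb_def)
qed

lemma meval_perturb:
  assumes "type_hom \<phi>" "finite I" "J \<subseteq> I"
  shows "meval type_ring (\<lambda>r. r) (\<lambda>i. if i \<in> J then s i else 0) (perturb \<phi> a I w h)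
    = meval type_ring \<phi> (\<lambda>j. a j + (\<Sum>i\<in>J. s i * w i j)) h"
proof -
  have "(\<Sum>i\<in>I. (if i \<in> J then s i else 0) * w i j) = (\<Sum>i\<in>J. s i * w i j)" for j
    by (rule sum.mono_neutral_cong_right) (use assms in auto)
  then show ?thesis
    unfolding perturb_def type_hom_meval[OF meval_hom[OF type_hom_id]]
    by (simp add: type_hom_simps[OF meval_hom[OF type_hom_id]] meval_mconst[OF type_hom_id]
        meval_mvar[OF type_hom_id])
qed

text \<open>A forward difference is by definition the Moebius inverse of the values at the cube vertices,
  and \<open>meval_cube_vertex\<close> exhibits those values as sums over subsets.\<close>

lemma fdiff_weighted:
  assumes "type_hom \<phi>" "finite I" "J \<subseteq> I"
  shows "fdiff (\<lambda>z. meval type_ring \<phi> z h) a J (\<lambda>i l. s i * w i l)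
    = (\<Prod>i\<in>J. s i) * weighted_coeff s J (perturb \<phi> a I w h)"
proof -
  let ?F = "perturb \<phi> a I w h"
  have "(\<Prod>i\<in>J. s i) * weighted_coeff s J ?F = (\<Sum>T\<in>Pow J. (-1) ^ (card J - card T) *
      meval type_ring (\<lambda>r. r) (\<lambda>i. if i \<in> T then s i else 0) ?F)"
    by (rule inclusion_exclusion_mobius[OF meval_cube_vertex])
      (use assms finite_subset in auto)
  also have "\<dots> = fdiff (\<lambda>z. meval type_ring \<phi> z h) a J (\<lambda>i l. s i * w i l)"
    unfolding fdiff_def by (rule sum.cong[OF refl]) (use assms in \<open>simp add: meval_perturb\<close>)
  finally show ?thesis ..
qed

text \<open>Under \<open>t \<mapsto> 0\<close> the coefficient becomes that of the perturbed polynomial over \<open>R\<close> with all weights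
  \<open>0\<close>, the algebra with \<open>\<epsilon>\<^sub>i\<^sup>2 = 0\<close> in which the differential is defined.\<close>

lemma weighted_coeff_0_pdiff:
  fixes a :: "nat \<Rightarrow> 'a::comm_ring_1 poly"
  assumes "finite I" "\<And>i. i \<in> I \<Longrightarrow> poly (s i) 0 = 0"
  shows "poly (weighted_coeff s I (perturb (\<lambda>r. [:r:]) a I w h)) 0
    = pdiff h (\<lambda>j. poly (a j) 0) I (\<lambda>i j. poly (w i j) 0)"
proof -
  let ?\<psi> = "\<lambda>c. mconst (poly c 0)"
  have hom: "type_hom ?\<psi>" by (rule type_hom_comp[OF type_hom_mconst type_hom_poly])
  have "meval type_ring ?\<psi> mvar (perturb (\<lambda>r. [:r:]) a I w h)
      = perturb (\<lambda>r. r) (\<lambda>j. poly (a j) 0) I (\<lambda>i j. poly (w i j) 0) h"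
    unfolding perturb_def type_hom_meval[OF meval_hom[OF hom]]
    by (simp add: type_hom_simps[OF meval_hom[OF hom]] meval_mconst[OF hom] meval_mvar[OF hom])
  moreover have "weighted_coeff (\<lambda>i. poly (s i) 0) I F = weighted_coeff (\<lambda>_. 0) I F" for F
    unfolding weighted_coeff_def by (intro sum.cong if_cong refl arg_cong2[of _ _ _ _ "(*)"] prod.cong)
      (use assms in auto)
  ultimately show ?thesis
    unfolding pdiff_def using sq_coeff_meval[OF assms(1) order.refl, of 0 "\<lambda>r::'a. r"]
    by (simp add: weighted_coeff_map[OF type_hom_poly])
qed

section \<open>The chain rule for forward differences\<close>

text \<open>Moebius inversion in the reverse direction: the value at the top vertex of a cube is recovered from the
  differences over all its faces.\<close>

lemma fdiff_expand:
  assumes "finite I"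
  shows "h (\<lambda>j. a j + (\<Sum>i\<in>I. w i j)) = (\<Sum>J\<in>Pow I. fdiff h a J w)"
proof -
  let ?g = "\<lambda>J. h (\<lambda>j. a j + (\<Sum>i\<in>J. w i j))"
  have "?g I = (\<Sum>J\<in>Pow I. (-1) ^ card J * (\<Sum>K\<in>Pow J. (-1) ^ card K * ?g K))"
    by (rule inclusion_exclusion_symmetric[OF refl assms])
  also have "\<dots> = (\<Sum>J\<in>Pow I. fdiff h a J w)"
    unfolding fdiff_def sum_distrib_left
  proof (intro sum.cong refl)
    fix J K assume "J \<in> Pow I" "K \<in> Pow J"
    then have "card K \<le> card J" using assms by (auto intro: card_mono finite_subset)
    then show "(-1) ^ card J * ((-1) ^ card K * ?g K) = (-1) ^ (card J - card K) * ?g K"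
      by (simp add: neg_one_power_add_eq_neg_one_power_diff flip: power_add mult.assoc)
  qed
  finally show ?thesis .
qed

text \<open>Expanding the inner functions at a vertex \<open>J\<close> displays the argument of \<open>g\<close> as the top vertex of a new
  cube, with one direction for each nonempty \<open>T \<subseteq> J\<close>. Expanding \<open>g\<close> on that cube gives one term for
  every family \<open>H\<close> of such \<open>T\<close>; grouping the families by their union \<open>\<Union>H \<subseteq> J\<close> is what makes a
  second inversion applicable.\<close>

lemma fdiff_compose:
  assumes "finite S"
  shows "fdiff (\<lambda>z. g (\<lambda>j. f j z)) a S w
    = (\<Sum>H\<in>coverings S. fdiff g (\<lambda>j. f j a) H (\<lambda>T j. fdiff (f j) a T w))"
proof -
  let ?D = "\<lambda>T j. fdiff (f j) a T w"
  let ?c = "\<lambda>H. fdiff g (\<lambda>j. f j a) H ?D"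
  let ?G = "\<lambda>J. g (\<lambda>j. f j (\<lambda>l. a l + (\<Sum>i\<in>J. w i l)))"
  have "?G J = (\<Sum>T\<in>Pow J. \<Sum>H\<in>coverings T. ?c H)" if J: "finite J" for J
  proof -
    have "f j (\<lambda>l. a l + (\<Sum>i\<in>J. w i l)) = f j a + (\<Sum>T\<in>Pow J - {{}}. ?D T j)" for j
    proof -
      have "?D {} j = f j a" by (simp add: fdiff_def)
      then show ?thesis
        unfolding fdiff_expand[OF J] by (subst sum.remove[of _ "{}"]) (use J in auto)
    qed
    then have "?G J = (\<Sum>H\<in>Pow (Pow J - {{}}). ?c H)"
      using fdiff_expand[of "Pow J - {{}}" g "\<lambda>j. f j a" ?D] J by simp
    also have "\<dots> = (\<Sum>T\<in>Pow J. \<Sum>H | H \<in> Pow (Pow J - {{}}) \<and> \<Union>H = T. ?c H)"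
      by (rule sum.group[symmetric]) (use J in auto)
    also have "\<dots> = (\<Sum>T\<in>Pow J. \<Sum>H\<in>coverings T. ?c H)"
      unfolding coverings_def by (intro sum.cong) auto
    finally show ?thesis .
  qed
  from inclusion_exclusion_mobius[OF this assms] show ?thesis
    by (simp add: fdiff_def)
qed

section \<open>Weights of coverings\<close>

text \<open>Double counting of the incidences \<open>i \<in> T \<in> H\<close>.\<close>

lemma wt_eq:
  assumes "finite S" "H \<in> coverings S"
  shows "wt H = (\<Sum>i\<in>S. card {T\<in>H. i \<in> T})"
proof -
  have fin: "finite H" "H \<subseteq> Pow S"
    using assms by (auto simp: coverings_def intro: finite_subset[of _ "Pow S"])
  have "wt H = (\<Sum>T\<in>H. \<Sum>i | i \<in> S \<and> i \<in> T. 1)"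
    unfolding wt_def using fin(2) by (intro sum.cong) (auto intro: arg_cong[of _ _ card])
  also have "\<dots> = (\<Sum>i\<in>S. \<Sum>T | T \<in> H \<and> i \<in> T. 1)"
    by (rule sum.swap_restrict[OF fin(1) assms(1)])
  finally show ?thesis by simp
qed

lemma covering_multiplicity:
  assumes "finite S" "H \<in> coverings S" "i \<in> S"
  shows "1 \<le> card {T\<in>H. i \<in> T}"
proof -
  have "finite {T\<in>H. i \<in> T}" "{T\<in>H. i \<in> T} \<noteq> {}"
    using assms by (auto simp: coverings_def intro: finite_subset[of _ "Pow S"])
  then show ?thesis by (simp add: Suc_le_eq card_gt_0_iff)
qed

lemma card_le_wt:
  assumes "finite S" "H \<in> coverings S"
  shows "card S \<le> wt H"
  using sum_mono[of S "\<lambda>_. 1", OF covering_multiplicity[OF assms]]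
  by (simp add: wt_eq[OF assms])

text \<open>Every point of \<open>S\<close> is covered at least once, so the weight is minimal exactly when every point is
  covered once, which is disjointness of the blocks.\<close>

lemma wt_eq_card_iff:
  assumes "finite S" "H \<in> coverings S"
  shows "wt H = card S \<longleftrightarrow> partition_on S H"
proof -
  have "(\<Sum>i\<in>S. 1) = (\<Sum>i\<in>S. card {T\<in>H. i \<in> T})
      \<longleftrightarrow> (\<forall>i\<in>S. card {T\<in>H. i \<in> T} = 1)"
    using sum_mono_inv[of "\<lambda>_. 1" S "\<lambda>i. card {T\<in>H. i \<in> T}"]
      covering_multiplicity[OF assms] assms(1) by fastforce
  then have "wt H = card S \<longleftrightarrow> (\<forall>i\<in>S. card {T\<in>H. i \<in> T} = 1)"
    by (auto simp: wt_eq[OF assms])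
  also have "\<dots> \<longleftrightarrow> disjoint H"
  proof
    assume one: "\<forall>i\<in>S. card {T\<in>H. i \<in> T} = 1"
    show "disjoint H"
    proof (rule disjointI, rule ccontr)
      fix T U assume TU: "T \<in> H" "U \<in> H" "T \<noteq> U" "T \<inter> U \<noteq> {}"
      then obtain i where i: "i \<in> T" "i \<in> U" by blast
      with TU assms one have "card {T\<in>H. i \<in> T} = 1" by (auto simp: coverings_def)
      then obtain V where V: "{T\<in>H. i \<in> T} = {V}" by (rule card_1_singletonE)
      have "T \<in> {T\<in>H. i \<in> T}" "U \<in> {T\<in>H. i \<in> T}" using TU i by simp_all
      then show False using TU(3) unfolding V by simp
    qed
  next
    assume dis: "disjoint H"
    show "\<forall>i\<in>S. card {T\<in>H. i \<in> T} = 1"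
    proof
      fix i assume "i \<in> S"
      with assms(2) obtain T where T: "T \<in> H" "i \<in> T" by (auto simp: coverings_def)
      with dis have "{T\<in>H. i \<in> T} = {T}" by (auto simp: disjoint_def)
      then show "card {T\<in>H. i \<in> T} = 1" by simp
    qed
  qed
  also have "\<dots> \<longleftrightarrow> partition_on S H"
    using assms(2) by (auto simp: partition_on_def coverings_def)
  finally show ?thesis .
qed

lemma partitions_eq:
  assumes "finite S"
  shows "{\<pi>. partition_on S \<pi>} = {H \<in> coverings S. wt H = card S}"
proof -
  have "partition_on S \<pi> \<Longrightarrow> \<pi> \<in> coverings S" for \<pi>
    by (auto simp: partition_on_def coverings_def)
  then show ?thesis using wt_eq_card_iff[OF assms] by auto
qed

section \<open>The chain rule for polynomials\<close>

lemma tvar_power: "tvar ^ n = monom (1::'a::comm_ring_1) n"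
  by (simp add: monom_altdef)

lemma poly_shift_mult: "poly_shift n (tvar ^ n * f) = f"
  unfolding tvar_power by (simp add: poly_eq_iff coeff_poly_shift coeff_monom_mult)

lemma inner_diff_eq:
  fixes q :: "nat \<Rightarrow> (nat, 'a::comm_ring_1) mpol"
  assumes "finite T"
  shows "inner_diff q x v T j = tvar ^ card T * weighted_coeff (\<lambda>_. tvar) T
    (perturb (\<lambda>r. [:r:]) (\<lambda>l. [:x l:]) T (\<lambda>i l. [:v i l:]) (q j))"
  unfolding inner_diff_def
  using fdiff_weighted[OF type_hom_const_poly assms order.refl, of "q j" "\<lambda>l. [:x l:]" "\<lambda>_. tvar"
      "\<lambda>i l. [:v i l:]"]
  by (simp only: prod_constant)

text \<open>The inner differences are \<open>t\<^bsup>|T|\<^esup> u\<^sub>T\<close>, so the outer difference has directions \<open>u\<^sub>T\<close> with weights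
  \<open>t\<^bsup>|T|\<^esup>\<close>. Their product is \<open>t\<^bsup>wt H\<^esup>\<close>, and each of them vanishes at \<open>t = 0\<close> because the members of a
  covering are nonempty; hence the cofactor specialises to a differential.\<close>

lemma cover_diff_eq:
  fixes p :: "(nat, 'a::comm_ring_1) mpol"
  assumes "finite S" "H \<in> coverings S"
  shows "\<exists>g. cover_diff p q x v H = tvar ^ wt H * g \<and> poly g 0 = part_diff p q x v H"
proof -
  define u where "u T j = weighted_coeff (\<lambda>_. tvar) T
    (perturb (\<lambda>r. [:r:]) (\<lambda>l. [:x l:]) T (\<lambda>i l. [:v i l:]) (q j))" for T j
  define g where "g = weighted_coeff (\<lambda>T. tvar ^ card T) H
    (perturb (\<lambda>r. [:r:]) (\<lambda>j. [:meval_self x (q j):]) H u p)"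
  have sub: "H \<subseteq> Pow S - {{}}" using assms(2) by (simp add: coverings_def)
  have fin: "finite H" using assms(1) by (intro finite_subset[OF sub]) simp
  have T: "finite T" "T \<noteq> {}" if "T \<in> H" for T
    using sub that assms(1) by (auto intro: finite_subset[of _ S])
  have "cover_diff p q x v H = fdiff (\<lambda>z. meval_poly z p) (\<lambda>j. [:meval_self x (q j):]) H
      (\<lambda>T j. tvar ^ card T * u T j)"
    unfolding cover_diff_def fdiff_def
    by (intro sum.cong refl arg_cong2[of _ _ _ _ "(*)"] arg_cong[of _ _ "\<lambda>z. meval_poly z p"] ext
        arg_cong2[of _ _ _ _ "(+)"]) (use T in \<open>auto simp: inner_diff_eq u_def\<close>)
  also have "\<dots> = (\<Prod>T\<in>H. tvar ^ card T) * g"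
    unfolding g_def by (rule fdiff_weighted[OF type_hom_const_poly fin order.refl])
  finally have 1: "cover_diff p q x v H = tvar ^ wt H * g"
    by (simp add: wt_def power_sum)
  have "poly (u T j) 0 = pdiff (q j) x T v" if "T \<in> H" for T j
    unfolding u_def using T[OF that] by (subst weighted_coeff_0_pdiff) simp_all
  then have u: "sq_point H 0 a (\<lambda>T j. poly (u T j) 0) = sq_point H 0 a (\<lambda>T j. pdiff (q j) x T v)"
    for a
    unfolding sq_point_def by (intro ext arg_cong[of _ _ "sq_class H 0"]) (simp cong: sum.cong)
  have "poly g 0 = pdiff p (\<lambda>j. meval_self x (q j)) H (\<lambda>T j. poly (u T j) 0)"
    unfolding g_def using T fin by (subst weighted_coeff_0_pdiff) (simp_all add: card_gt_0_iff zero_power)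
  then have 2: "poly g 0 = part_diff p q x v H"
    unfolding part_diff_def pdiff_def u .
  from 1 2 show ?thesis by blast
qed

text \<open>The left-hand side is the forward difference of the function \<open>z \<mapsto> p(q(z))\<close> in the directions
  \<open>t v\<^sub>i\<close>, \<open>i \<in> S\<close>. The remaining variables \<open>X\<^sub>i\<close>, \<open>i \<in> {1..k} - S\<close>, have value \<open>0\<close> at the vertices
  involved.\<close>

lemma comp_coeff_eq:
  fixes p :: "(nat, 'a::comm_ring_1) mpol"
  assumes "mvars p \<subseteq> {1..d}" "\<And>j. j \<in> {1..d} \<Longrightarrow> mvars (q j) \<subseteq> {1..e}" "S \<subseteq> {1..k}"
  shows "tvar ^ card S * comp_coeff e k p q x v S = (\<Sum>H\<in>coverings S. cover_diff p q x v H)"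
proof -
  let ?a = "\<lambda>l. [:x l:]" and ?w = "\<lambda>i l. [:v i l:]"
  let ?f = "\<lambda>j z. meval_poly z (q j)"
  have "mcomp e p q = meval type_ring mconst q p"
    unfolding mcomp_def by (rule meval_mring) (use subsetD[OF assms(1)] assms(2) in auto)
  then have comp: "meval_poly z (mcomp e p q) = meval_poly (\<lambda>j. ?f j z) p" for z
    by (simp add: type_hom_meval[OF meval_hom[OF type_hom_const_poly]]
        meval_mconst[OF type_hom_const_poly])
  have "tvar ^ card S * comp_coeff e k p q x v S
      = fdiff (\<lambda>z. meval_poly z (mcomp e p q)) ?a S (\<lambda>i l. tvar * ?w i l)"
    unfolding comp_coeff_def
    using fdiff_weighted[OF type_hom_const_poly finite_atLeastAtMost assms(3), of _ ?a "\<lambda>_. tvar" ?w]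
    by (simp only: sq_coeff_meval[OF finite_atLeastAtMost assms(3)] prod_constant)
  also have "\<dots> = (\<Sum>H\<in>coverings S. fdiff (\<lambda>z. meval_poly z p) (\<lambda>j. ?f j ?a) H
      (\<lambda>T j. fdiff (?f j) ?a T (\<lambda>i l. tvar * ?w i l)))"
    unfolding comp by (rule fdiff_compose) (use assms(3) finite_subset in blast)
  also have "\<dots> = (\<Sum>H\<in>coverings S. cover_diff p q x v H)"
    unfolding cover_diff_def inner_diff_def[abs_def]
    by (simp add: type_hom_meval[OF type_hom_const_poly])
  finally show ?thesis .
qed

theorem theorem35:
  fixes e d k :: nat
    and p :: "(nat, 'r::comm_ring_1) mpol" and q :: "nat \<Rightarrow> (nat, 'r) mpol"
    and x :: "nat \<Rightarrow> 'r" and v :: "nat \<Rightarrow> nat \<Rightarrow> 'r" and S :: "nat set"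
  assumes p: "mvars p \<subseteq> {1..d}"
    and q: "\<And>j. j \<in> {1..d} \<Longrightarrow> mvars (q j) \<subseteq> {1..e}"
    and S: "S \<subseteq> {1..k}"
  shows "tvar ^ card S dvd (\<Sum>H \<in> coverings S. cover_diff p q x v H) \<and>
    comp_coeff e k p q x v S
      = poly_shift (card S) (\<Sum>H \<in> coverings S. cover_diff p q x v H) \<and>
    poly (comp_coeff e k p q x v S) 0 = (\<Sum>\<pi> | partition_on S \<pi>. part_diff p q x v \<pi>) \<and>
    (\<forall>T \<subseteq> S. \<forall>j \<in> {1..d}. tvar ^ card T dvd inner_diff q x v T j) \<and>
    (\<forall>H \<in> coverings S. tvar ^ wt H dvd cover_diff p q x v H) \<and>
    (\<forall>H \<in> coverings S. wt H = card S \<longleftrightarrow> partition_on S H) \<and>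
    (\<forall>H \<in> coverings S. card S < wt H \<longrightarrow>
      tvar ^ card S dvd cover_diff p q x v H \<and>
      poly (poly_shift (card S) (cover_diff p q x v H)) 0 = 0)"
proof -
  have fin: "finite S" using S by (rule finite_subset) simp
  have fin_cov: "finite (coverings S)"
    by (rule finite_subset[of _ "Pow (Pow S)"]) (use fin in \<open>auto simp: coverings_def\<close>)
  \<comment> \<open>the cofactor of \<open>t\<^bsup>wt H\<^esup>\<close> whose value at \<open>0\<close> is the differential: \<open>t\<close> is not a zero divisor, so it is unique\<close>
  define g where "g H = (SOME g. cover_diff p q x v H = tvar ^ wt H * g
      \<and> poly g 0 = part_diff p q x v H)" for H
  have g: "cover_diff p q x v H = tvar ^ wt H * g H" "poly (g H) 0 = part_diff p q x v H"
    if "H \<in> coverings S" for H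
    using someI_ex[OF cover_diff_eq[OF fin that, of p q x v]] unfolding g_def by blast+
  have cover: "cover_diff p q x v H = tvar ^ card S * (tvar ^ (wt H - card S) * g H)"
    if "H \<in> coverings S" for H
    unfolding g(1)[OF that] mult.assoc[symmetric] power_add[symmetric]
      le_add_diff_inverse[OF card_le_wt[OF fin that]] ..
  note comp = comp_coeff_eq[OF p q S, where x = x and v = v]
  have coeff: "comp_coeff e k p q x v S
      = poly_shift (card S) (\<Sum>H\<in>coverings S. cover_diff p q x v H)"
    by (simp only: comp[symmetric] poly_shift_mult)
  have "(\<Sum>H\<in>coverings S. cover_diff p q x v H)
      = tvar ^ card S * (\<Sum>H\<in>coverings S. tvar ^ (wt H - card S) * g H)"
    unfolding sum_distrib_left by (rule sum.cong[OF refl cover])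
  then have "comp_coeff e k p q x v S = (\<Sum>H\<in>coverings S. tvar ^ (wt H - card S) * g H)"
    unfolding coeff by (simp only: poly_shift_mult)
  then have "poly (comp_coeff e k p q x v S) 0
      = (\<Sum>H\<in>coverings S. 0 ^ (wt H - card S) * part_diff p q x v H)"
    by (simp add: poly_sum g(2))
  also have "\<dots> = (\<Sum>H\<in>coverings S. if wt H = card S then part_diff p q x v H else 0)"
    by (rule sum.cong[OF refl]) (use card_le_wt[OF fin] in \<open>fastforce simp: power_0_left\<close>)
  also have "\<dots> = (\<Sum>\<pi> | partition_on S \<pi>. part_diff p q x v \<pi>)"
    unfolding partitions_eq[OF fin] by (rule sum.inter_filter[OF fin_cov, symmetric])
  finally have at0: "poly (comp_coeff e k p q x v S) 0
      = (\<Sum>\<pi> | partition_on S \<pi>. part_diff p q x v \<pi>)" .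
  have "tvar ^ card S dvd cover_diff p q x v H \<and>
      poly (poly_shift (card S) (cover_diff p q x v H)) 0 = 0"
    if "H \<in> coverings S" "card S < wt H" for H
    using that(2) unfolding cover[OF that(1)] poly_shift_mult by (simp add: zero_power)
  moreover have "tvar ^ card T dvd inner_diff q x v T j" if "T \<subseteq> S" for T j
    using inner_diff_eq[OF finite_subset[OF that fin], of q x v j] by simp
  moreover have "tvar ^ wt H dvd cover_diff p q x v H" if "H \<in> coverings S" for H
    using g(1)[OF that] by simp
  moreover have "tvar ^ card S dvd (\<Sum>H\<in>coverings S. cover_diff p q x v H)"
    by (simp only: comp[symmetric] dvd_triv_left)
  ultimately show ?thesis
    using coeff at0 wt_eq_card_iff[OF fin] by blast
qed

end
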